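(* Let $H\in(1/2,3/4)$. The statistics $$\widehat H_k^{(4)}=-\frac1{2k}\log_{2+}U_k^{H,4}\qquad\text{and}\qquad\widetilde H_k^{(4)}=\frac12\log_{2+}\frac{U_k^{H,4}}{U_{k+1}^{H,4}}$$ are strongly consistent estimators of the Hurst parameter $H$ in the mixed model $M^H_t=aB^H_t+bW_t$, $t\in[0,T]$; that is, both converge to $H$ almost surely as $k\to\infty$.
   Context: Mixed model: $M_t^H=aB_t^H+bW_t$, $t\in[0,T]$, where $T>0$, $a>0$, $b>0$, $W$ is a standard Wiener process and $B^H$ is a fractional Brownian motion with Hurst parameter $H$ (centered Gaussian, $\mathsf{E}[B^H_tB^H_s]=\frac12(t^{2H}+s^{2H}-|t-s|^{2H})$), independent of $W$. For $n\ge1$, $\Delta_i^nX=X_{T(i+1)/n}-X_{Ti/n}$, $i=0,\dots,n-1$; $V_n^{H,4}=\sum_{i=0}^{n-1}(\Delta_i^nM^H)^4$; $U_k^{H,4}=V_{2^k}^{H,4}-2V_{2^{k+1}}^{H,4}$; $\log_{2+}x=\log_2x$ for $x>0$ and $\log_{2+}x=0$ for $x\le0$. *)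

theory Defs
  imports "HOL-Probability.Probability"
begin

text \<open>Constants count as (degenerate) Gaussian variables, as is needed for linear combinations
  of the values of a Gaussian process.\<close>

definition gaussian_rv :: "'a measure \<Rightarrow> ('a \<Rightarrow> real) \<Rightarrow> bool" where
  "gaussian_rv M X \<longleftrightarrow> X \<in> borel_measurable M \<and>
     (\<exists>\<mu> \<sigma>. \<sigma> > 0 \<and> distributed M lborel X (normal_density \<mu> \<sigma>) \<or> (AE \<omega> in M. X \<omega> = \<mu>))"

text \<open>All finite-dimensional distributions over \<open>I\<close> are multivariate normal,
  i.e. every finite linear combination is Gaussian.\<close>

definition gaussian_process :: "'a measure \<Rightarrow> real set \<Rightarrow> (real \<Rightarrow> 'a \<Rightarrow> real) \<Rightarrow> bool" where
  "gaussian_process M I X \<longleftrightarrow>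
     (\<forall>J c. finite J \<and> J \<subseteq> I \<longrightarrow> gaussian_rv M (\<lambda>\<omega>. \<Sum>t\<in>J. c t * X t \<omega>))"

definition fractional_brownian_motion ::
  "'a measure \<Rightarrow> real set \<Rightarrow> real \<Rightarrow> (real \<Rightarrow> 'a \<Rightarrow> real) \<Rightarrow> bool" where
  "fractional_brownian_motion M I H B \<longleftrightarrow>
     gaussian_process M I B \<and>
     (\<forall>t\<in>I. (\<integral>\<omega>. B t \<omega> \<partial>M) = 0) \<and>
     (\<forall>t\<in>I. \<forall>s\<in>I. (\<integral>\<omega>. B t \<omega> * B s \<omega> \<partial>M) =
        1/2 * (t powr (2*H) + s powr (2*H) - \<bar>t - s\<bar> powr (2*H)))"

definition wiener_process :: "'a measure \<Rightarrow> real set \<Rightarrow> (real \<Rightarrow> 'a \<Rightarrow> real) \<Rightarrow> bool" where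
  "wiener_process M I W \<longleftrightarrow>
     (\<forall>t\<in>I. W t \<in> borel_measurable M) \<and>
     (AE \<omega> in M. W 0 \<omega> = 0) \<and>
     (\<forall>n \<tau>. mono_on {..n} \<tau> \<and> \<tau> ` {..n} \<subseteq> I \<longrightarrow>
        prob_space.indep_vars M (\<lambda>_. borel)
          (\<lambda>i \<omega>. W (\<tau> (Suc i)) \<omega> - W (\<tau> i) \<omega>) {..<n::nat}) \<and>
     (\<forall>s\<in>I. \<forall>t\<in>I. s < t \<longrightarrow>
        distributed M lborel (\<lambda>\<omega>. W t \<omega> - W s \<omega>) (normal_density 0 (sqrt (t - s)))) \<and>
     (AE \<omega> in M. continuous_on I (\<lambda>t. W t \<omega>))"

text \<open>Independence of the processes as random elements of the product space \<open>\<real>\<^sup>I\<close>, i.e. of the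
  \<open>\<sigma>\<close>-algebras they generate.\<close>

definition independent_processes ::
  "'a measure \<Rightarrow> real set \<Rightarrow> (real \<Rightarrow> 'a \<Rightarrow> real) \<Rightarrow> (real \<Rightarrow> 'a \<Rightarrow> real) \<Rightarrow> bool" where
  "independent_processes M I X Y \<longleftrightarrow>
     prob_space.indep_var M
       (Pi\<^sub>M I (\<lambda>_. borel)) (\<lambda>\<omega>. \<lambda>t\<in>I. X t \<omega>)
       (Pi\<^sub>M I (\<lambda>_. borel)) (\<lambda>\<omega>. \<lambda>t\<in>I. Y t \<omega>)"

definition mixed_model ::
  "real \<Rightarrow> real \<Rightarrow> (real \<Rightarrow> 'a \<Rightarrow> real) \<Rightarrow> (real \<Rightarrow> 'a \<Rightarrow> real) \<Rightarrow> real \<Rightarrow> 'a \<Rightarrow> real" where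
  "mixed_model a b B W t \<omega> = a * B t \<omega> + b * W t \<omega>"

definition log2_plus :: "real \<Rightarrow> real" where
  "log2_plus x = (if x > 0 then log 2 x else 0)"

text \<open>The statistics are functionals of an observed path \<open>x\<close> on \<open>[0, T]\<close>.\<close>

definition increment :: "real \<Rightarrow> (real \<Rightarrow> real) \<Rightarrow> nat \<Rightarrow> nat \<Rightarrow> real" where
  "increment T x n i = x (T * (real i + 1) / real n) - x (T * real i / real n)"

definition quartic_variation :: "real \<Rightarrow> (real \<Rightarrow> real) \<Rightarrow> nat \<Rightarrow> real" where
  "quartic_variation T x n = (\<Sum>i<n. increment T x n i ^ 4)"

definition U4 :: "real \<Rightarrow> (real \<Rightarrow> real) \<Rightarrow> nat \<Rightarrow> real" where
  "U4 T x k = quartic_variation T x (2 ^ k) - 2 * quartic_variation T x (2 ^ (k + 1))"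

definition H_hat4 :: "real \<Rightarrow> (real \<Rightarrow> real) \<Rightarrow> nat \<Rightarrow> real" where
  "H_hat4 T x k = - (1 / (2 * real k)) * log2_plus (U4 T x k)"

text \<open>Since \<open>u / 0 = 0\<close> in HOL, the next statistic is \<open>0\<close> when \<open>U4 T x (k + 1) = 0\<close>.\<close>

definition H_tilde4 :: "real \<Rightarrow> (real \<Rightarrow> real) \<Rightarrow> nat \<Rightarrow> real" where
  "H_tilde4 T x k = 1/2 * log2_plus (U4 T x k / U4 T x (k + 1))"

definition strongly_consistent ::
  "'a measure \<Rightarrow> (real \<Rightarrow> 'a \<Rightarrow> real) \<Rightarrow> ((real \<Rightarrow> real) \<Rightarrow> nat \<Rightarrow> real) \<Rightarrow> real \<Rightarrow> bool" where
  "strongly_consistent M X est \<theta> \<longleftrightarrow>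
     (AE \<omega> in M. (\<lambda>k. est (\<lambda>t. X t \<omega>) k) \<longlonglongrightarrow> \<theta>)"

end

theory Submission
  imports Defs
begin

text \<open>
  Put \<open>\<sigma>\<^sub>n\<^sup>2 = a\<^sup>2 (T/n)\<^bsup>2H\<^esup> + b\<^sup>2 T/n\<close>, the variance of an increment. Then \<open>E V\<^sub>n = 3 n \<sigma>\<^sub>n\<^sup>4\<close>, and in
  \<open>E U\<^sub>k\<close> the pure Wiener term \<open>b\<^sup>4 T\<^sup>2/n\<close> cancels, so that the mixed term dominates and
  \<open>2\<^bsup>2Hk\<^esup> E U\<^sub>k\<close> tends to a positive constant because \<open>H > 1/2\<close>. For jointly Gaussian centered \<open>X, Y\<close> of
  variance \<open>v\<close> and covariance \<open>r\<close> one has \<open>Cov(X\<^sup>4, Y\<^sup>4) = 72 v\<^sup>2 r\<^sup>2 + 24 r\<^sup>4 \<le> 96 v\<^sup>2 r\<^sup>2\<close>, and since the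
  squared covariances of fractional Gaussian noise are summable for \<open>H < 3/4\<close>, \<open>Var V\<^sub>n = O(n\<^bsup>-3\<^esup>)\<close>.
  Hence \<open>2\<^bsup>4Hk\<^esup> Var V\<close> at \<open>n = 2\<^sup>k\<close> is summable over \<open>k\<close>, so \<open>2\<^bsup>2Hk\<^esup> U\<^sub>k\<close> converges almost surely to the
  same positive constant.
\<close>

section \<open>Centered Gaussian variables\<close>

text \<open>A Gaussian variable is integrable, so the vanishing integral is a genuine mean and not
  the default value of the Bochner integral.\<close>

definition centered_gaussian :: "'a measure \<Rightarrow> ('a \<Rightarrow> real) \<Rightarrow> bool" where
  "centered_gaussian M X \<longleftrightarrow> gaussian_rv M X \<and> (\<integral>\<omega>. X \<omega> \<partial>M) = 0"

context prob_space
begin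

text \<open>The mean forces \<open>\<mu> = 0\<close> in both alternatives. The degenerate case stays
  separate, since \<open>normal_density 0 0\<close> is not a probability density.\<close>

lemma centered_gaussian_cases:
  assumes "centered_gaussian M X"
  obtains \<sigma> where "\<sigma> > 0" "distributed M lborel X (normal_density 0 \<sigma>)"
  | "AE \<omega> in M. X \<omega> = 0"
proof -
  have X: "X \<in> borel_measurable M" and E: "expectation X = 0"
    using assms by (auto simp: centered_gaussian_def gaussian_rv_def)
  obtain \<mu> \<sigma> where "\<sigma> > 0 \<and> distributed M lborel X (normal_density \<mu> \<sigma>) \<or> (AE \<omega> in M. X \<omega> = \<mu>)"
    using assms by (auto simp: centered_gaussian_def gaussian_rv_def)
  then show thesis
  proof
    assume *: "\<sigma> > 0 \<and> distributed M lborel X (normal_density \<mu> \<sigma>)"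
    then have "expectation X = \<mu>"
      by (intro normal_distributed_expectation) auto
    with * E show thesis using that(1) by auto
  next
    assume *: "AE \<omega> in M. X \<omega> = \<mu>"
    then have "expectation X = expectation (\<lambda>_. \<mu>)"
      using X by (intro integral_cong_AE) auto
    then have "\<mu> = 0" using E by (simp add: prob_space)
    with * show thesis using that(2) by auto
  qed
qed

lemma centered_gaussian_measurable [measurable_dest]:
  "centered_gaussian M X \<Longrightarrow> X \<in> borel_measurable M"
  by (simp add: centered_gaussian_def gaussian_rv_def)

lemma centered_gaussian_integrable_power:
  assumes "centered_gaussian M X"
  shows "integrable M (\<lambda>\<omega>. X \<omega> ^ k)"
  using assms
proof (cases rule: centered_gaussian_cases)
  case (1 \<sigma>)
  then show ?thesis
    using distributed_integrable[OF 1(2), of "\<lambda>x. x ^ k"] integrable_normal_moment[of \<sigma> 0 k]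
    by simp
next
  case 2
  have "integrable M (\<lambda>\<omega>. X \<omega> ^ k) = integrable M (\<lambda>\<omega>. 0 ^ k :: real)"
    using 2 centered_gaussian_measurable[OF assms] by (intro integrable_cong_AE) auto
  then show ?thesis by simp
qed

lemma centered_gaussian_integrable: "centered_gaussian M X \<Longrightarrow> integrable M X"
  using centered_gaussian_integrable_power[of X 1] by simp

text \<open>The factor is the double factorial (2k-1)!!. Writing the moment through the variance
  instead of \<open>\<sigma>\<close> lets one formula cover the degenerate case as well.\<close>

lemma centered_gaussian_even_moment:
  assumes "centered_gaussian M X"
  shows "expectation (\<lambda>\<omega>. X \<omega> ^ (2 * k)) =
    fact (2 * k) / (2 ^ k * fact k) * expectation (\<lambda>\<omega>. (X \<omega>)\<^sup>2) ^ k"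
  using assms
proof (cases rule: centered_gaussian_cases)
  case (1 \<sigma>)
  have *: "expectation (\<lambda>\<omega>. X \<omega> ^ (2 * j)) = fact (2 * j) / ((2 / \<sigma>\<^sup>2) ^ j * fact j)" for j
    using distributed_integral[OF 1(2), of "\<lambda>x. x ^ (2 * j)"]
      integral_normal_moment_even[OF 1(1), of 0 j] by simp
  from *[of 1] 1(1) have "expectation (\<lambda>\<omega>. (X \<omega>)\<^sup>2) = \<sigma>\<^sup>2" by simp
  then show ?thesis using * 1(1) by (simp add: field_simps power_divide)
next
  case 2
  have *: "expectation (\<lambda>\<omega>. X \<omega> ^ j) = 0 ^ j" for j
  proof -
    have "expectation (\<lambda>\<omega>. X \<omega> ^ j) = expectation (\<lambda>\<omega>. 0 ^ j :: real)"
      using 2 centered_gaussian_measurable[OF assms] by (intro integral_cong_AE) auto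
    then show ?thesis by (simp add: prob_space)
  qed
  \<comment> \<open>For \<open>k = 0\<close> both sides are 1, because \<open>0 ^ 0 = 1\<close>;
    otherwise both vanish.\<close>
  show ?thesis using *[of "2 * k"] *[of 2] by (cases "k = 0") (auto simp: power_0_left)
qed

lemma centered_gaussian_fourth_moment:
  "centered_gaussian M X \<Longrightarrow>
    expectation (\<lambda>\<omega>. X \<omega> ^ 4) = 3 * (expectation (\<lambda>\<omega>. (X \<omega>)\<^sup>2))\<^sup>2"
  using centered_gaussian_even_moment[of X 2] by (simp add: fact_numeral)

lemma centered_gaussian_eighth_moment:
  "centered_gaussian M X \<Longrightarrow>
    expectation (\<lambda>\<omega>. X \<omega> ^ 8) = 105 * expectation (\<lambda>\<omega>. (X \<omega>)\<^sup>2) ^ 4"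
  using centered_gaussian_even_moment[of X 4] by (simp add: fact_numeral)

lemma centered_gaussian_scale:
  assumes "centered_gaussian M X"
  shows "centered_gaussian M (\<lambda>\<omega>. c * X \<omega>)"
proof -
  have [measurable]: "X \<in> borel_measurable M" and E: "expectation (\<lambda>\<omega>. c * X \<omega>) = 0"
    using assms by (auto simp: centered_gaussian_def gaussian_rv_def)
  have "gaussian_rv M (\<lambda>\<omega>. c * X \<omega>)"
    using assms
  proof (cases rule: centered_gaussian_cases)
    case (1 \<sigma>)
    show ?thesis
    proof (cases "c = 0")
      case True
      then show ?thesis by (auto simp: gaussian_rv_def)
    next
      case False
      then have "distributed M lborel (\<lambda>\<omega>. 0 + c * X \<omega>) (normal_density (0 + c * 0) (\<bar>c\<bar> * \<sigma>))"
        using 1 by (intro normal_density_affine) auto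
      moreover have "\<bar>c\<bar> * \<sigma> > 0" using 1 False by simp
      ultimately show ?thesis unfolding gaussian_rv_def by (auto simp del: zero_less_mult_iff)
    qed
  next
    case 2
    then have "AE \<omega> in M. c * X \<omega> = 0" by auto
    then show ?thesis unfolding gaussian_rv_def by (intro conjI) (measurable, blast)
  qed
  with E show ?thesis by (simp add: centered_gaussian_def)
qed

lemma centered_gaussian_AE_cong:
  assumes "centered_gaussian M X" "AE \<omega> in M. X \<omega> = Y \<omega>" "Y \<in> borel_measurable M"
  shows "centered_gaussian M Y"
proof -
  have [measurable]: "X \<in> borel_measurable M" "Y \<in> borel_measurable M"
    using assms by (auto simp: centered_gaussian_def gaussian_rv_def)
  have "expectation X = expectation Y"
    using assms by (intro integral_cong_AE) auto
  moreover have "gaussian_rv M Y"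
    using assms(1)
  proof (cases rule: centered_gaussian_cases)
    case (1 \<sigma>)
    have "distr M lborel X = distr M lborel Y"
      by (rule distr_cong_AE) (use assms(2) in auto)
    with 1(2) have "distributed M lborel Y (normal_density 0 \<sigma>)"
      by (simp add: distributed_def)
    with 1(1) show ?thesis by (auto simp: gaussian_rv_def)
  next
    case 2
    with assms(2) have "AE \<omega> in M. Y \<omega> = 0" by eventually_elim auto
    then show ?thesis by (auto simp: gaussian_rv_def)
  qed
  ultimately show ?thesis using assms(1) by (simp add: centered_gaussian_def)
qed

text \<open>Two normal laws convolve to a normal law; if one summand vanishes almost everywhere, the
  sum agrees almost everywhere with the other.\<close>

lemma centered_gaussian_add_indep:
  assumes X: "centered_gaussian M X" and Y: "centered_gaussian M Y"
    and indep: "indep_var borel X borel Y"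
  shows "centered_gaussian M (\<lambda>\<omega>. X \<omega> + Y \<omega>)"
proof -
  have [measurable]: "X \<in> borel_measurable M" "Y \<in> borel_measurable M"
    using assms by (auto simp: centered_gaussian_def gaussian_rv_def)
  show ?thesis
    using X
  proof (cases rule: centered_gaussian_cases)
    case X1: (1 \<sigma>)
    show ?thesis using Y
    proof (cases rule: centered_gaussian_cases)
      case Y1: (1 \<tau>)
      have "distributed M lborel (\<lambda>\<omega>. X \<omega> + Y \<omega>) (normal_density (0 + 0) (sqrt (\<sigma>\<^sup>2 + \<tau>\<^sup>2)))"
        using X1 Y1 indep by (intro add_indep_normal)
      moreover have "sqrt (\<sigma>\<^sup>2 + \<tau>\<^sup>2) > 0" using X1 Y1 by (simp add: add_pos_pos)
      ultimately have "gaussian_rv M (\<lambda>\<omega>. X \<omega> + Y \<omega>)"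
        by (auto simp: gaussian_rv_def simp del: real_sqrt_gt_0_iff)
      then show ?thesis using X Y
        by (simp add: centered_gaussian_def centered_gaussian_integrable[OF X]
            centered_gaussian_integrable[OF Y])
    next
      case 2
      then have "AE \<omega> in M. X \<omega> = X \<omega> + Y \<omega>" by auto
      then show ?thesis by (rule centered_gaussian_AE_cong[OF X]) auto
    qed
  next
    case 2
    then have "AE \<omega> in M. Y \<omega> = X \<omega> + Y \<omega>" by auto
    then show ?thesis by (rule centered_gaussian_AE_cong[OF Y]) auto
  qed
qed

text \<open>Domination by the sum of the squares of the two factors, whose moments are finite. This
  settles the integrability of all products below.\<close>

lemma centered_gaussian_integrable_mult:
  assumes X: "centered_gaussian M X" and Y: "centered_gaussian M Y"
  shows "integrable M (\<lambda>\<omega>. X \<omega> ^ j * Y \<omega> ^ k)"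
proof (rule Bochner_Integration.integrable_bound)
  show "integrable M (\<lambda>\<omega>. X \<omega> ^ (j * 2) + Y \<omega> ^ (k * 2))"
    by (intro Bochner_Integration.integrable_add centered_gaussian_integrable_power X Y)
  show "(\<lambda>\<omega>. X \<omega> ^ j * Y \<omega> ^ k) \<in> borel_measurable M"
    using X Y by measurable
  have "\<bar>x * y\<bar> \<le> \<bar>x\<^sup>2 + y\<^sup>2\<bar>" for x y :: real
    using sum_squares_bound[of x y] sum_squares_bound[of x "-y"] by (simp add: abs_le_iff)
  then show "AE \<omega> in M. norm (X \<omega> ^ j * Y \<omega> ^ k) \<le> norm (X \<omega> ^ (j * 2) + Y \<omega> ^ (k * 2))"
    unfolding power_mult real_norm_def by (intro AE_I2)
qed

section \<open>Gaussian pairs: mixed fourth moments and sums of fourth powers\<close>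

text \<open>The Cramer-Wold form of a bivariate normal law. It admits singular covariance matrices
  and reduces mixed moments to one-dimensional ones.\<close>

definition jointly_centered_gaussian :: "('a \<Rightarrow> real) \<Rightarrow> ('a \<Rightarrow> real) \<Rightarrow> bool" where
  "jointly_centered_gaussian X Y \<longleftrightarrow> (\<forall>s t. centered_gaussian M (\<lambda>\<omega>. s * X \<omega> + t * Y \<omega>))"

lemma jointly_centered_gaussianD:
  assumes "jointly_centered_gaussian X Y"
  shows "centered_gaussian M (\<lambda>\<omega>. s * X \<omega> + t * Y \<omega>)" "centered_gaussian M X" "centered_gaussian M Y"
proof -
  have *: "centered_gaussian M (\<lambda>\<omega>. s * X \<omega> + t * Y \<omega>)" for s t
    using assms by (simp add: jointly_centered_gaussian_def)
  show "centered_gaussian M (\<lambda>\<omega>. s * X \<omega> + t * Y \<omega>)" "centered_gaussian M X" "centered_gaussian M Y"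
    using *[of s t] *[of 1 0] *[of 0 1] by simp_all
qed

text \<open>This is Wick's formula: of the 105 pairings of eight factors, 9 have no cross pair, 72
  have two and 24 have four. The proof reads it off the eighth moments of linear combinations,
  without a joint density.\<close>

lemma jointly_gaussian_fourth_powers:
  assumes J: "jointly_centered_gaussian X Y"
  defines "A \<equiv> expectation (\<lambda>\<omega>. (X \<omega>)\<^sup>2)" and "C \<equiv> expectation (\<lambda>\<omega>. (Y \<omega>)\<^sup>2)"
    and "r \<equiv> expectation (\<lambda>\<omega>. X \<omega> * Y \<omega>)"
  shows "expectation (\<lambda>\<omega>. X \<omega> ^ 4 * Y \<omega> ^ 4) = 9 * A\<^sup>2 * C\<^sup>2 + 72 * A * C * r\<^sup>2 + 24 * r ^ 4"
proof -
  note X = jointly_centered_gaussianD(2)[OF J] and Y = jointly_centered_gaussianD(3)[OF J]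
  define F where "F s t = (\<lambda>\<omega>. (s * X \<omega> + t * Y \<omega>) ^ 8)" for s t :: real
  have int: "integrable M (F s t)" for s t
    unfolding F_def by (intro centered_gaussian_integrable_power jointly_centered_gaussianD[OF J])
  have var: "expectation (\<lambda>\<omega>. (s * X \<omega> + t * Y \<omega>)\<^sup>2) = s\<^sup>2 * A + 2 * s * t * r + t\<^sup>2 * C" for s t
  proof -
    have "(\<lambda>\<omega>. (s * X \<omega> + t * Y \<omega>)\<^sup>2) = (\<lambda>\<omega>. s\<^sup>2 * (X \<omega>)\<^sup>2 + 2 * s * t * (X \<omega> * Y \<omega>) + t\<^sup>2 * (Y \<omega>)\<^sup>2)"
      by (auto simp: power2_eq_square algebra_simps)
    then show ?thesis
      using centered_gaussian_integrable_mult[OF X Y, of 1 1]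
      by (simp add: centered_gaussian_integrable_power[OF X] centered_gaussian_integrable_power[OF Y]
          A_def C_def r_def)
  qed
  have F: "expectation (F s t) = 105 * (s\<^sup>2 * A + 2 * s * t * r + t\<^sup>2 * C) ^ 4" for s t
    unfolding F_def var[symmetric]
    by (intro centered_gaussian_eighth_moment jointly_centered_gaussianD[OF J])
  \<comment> \<open>Polarization: \<open>(x + t y)^8 + (x - t y)^8 - 2 x^8 - 2 t^8 y^8\<close>, divided by \<open>2 t^4\<close>, is
    \<open>28 x^6 y^2 / t^2 + 70 x^4 y^4 + 28 x^2 y^6 t^2\<close>; the weights \<open>17/9, -4/9, -4/9\<close> at
    \<open>t = 1, 2, 1/2\<close> isolate the middle term. Everything is multiplied by \<open>288\<close> below.\<close>
  define G where "G f = 272 * (f 1 1 + f 1 (-1) - 2 * f 1 0 - 2 * f 0 1)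
     - 4 * (f 1 2 + f 1 (-2) - 2 * f 1 0 - 512 * f 0 1)
     - 4 * (f 2 1 + f 2 (-1) - 512 * f 1 0 - 2 * f 0 1)" for f :: "real \<Rightarrow> real \<Rightarrow> real"
  have pol: "20160 * (x ^ 4 * y ^ 4) = G (\<lambda>s t. (s * x + t * y) ^ 8)" for x y :: real
    unfolding G_def by (simp add: eval_nat_numeral algebra_simps)
  have "20160 * expectation (\<lambda>\<omega>. X \<omega> ^ 4 * Y \<omega> ^ 4) = expectation (\<lambda>\<omega>. G (\<lambda>s t. F s t \<omega>))"
    unfolding F_def pol[symmetric] by simp
  also have "\<dots> = G (\<lambda>s t. expectation (F s t))"
    unfolding G_def by (simp add: int)
  \<comment> \<open>\<open>G\<close> is linear, hence commutes with the expectation, and on any form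
    of degree 8 in \<open>s\<close> and \<open>t\<close> it returns 288 times the coefficient of
    \<open>s^4 t^4\<close>. Here 20160 = 70 * 288, where 70 is the binomial coefficient of that
    term.\<close>
  also have "\<dots> = 20160 * (9 * A\<^sup>2 * C\<^sup>2 + 72 * A * C * r\<^sup>2 + 24 * r ^ 4)"
    unfolding G_def F by (simp add: eval_nat_numeral algebra_simps)
  finally show ?thesis by simp
qed

text \<open>Expanding the square gives the double sum of the covariances of the fourth powers. Each
  is at most \<open>96 v^2 r^2\<close>, so a bound \<open>S\<close> on every row of squared
  covariances controls the whole sum.\<close>

lemma centered_gaussian_fourth_powers_sum:
  fixes X :: "nat \<Rightarrow> 'a \<Rightarrow> real"
  assumes J: "\<And>i j. i < n \<Longrightarrow> j < n \<Longrightarrow> jointly_centered_gaussian (X i) (X j)"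
    and v: "\<And>i. i < n \<Longrightarrow> expectation (\<lambda>\<omega>. (X i \<omega>)\<^sup>2) = v"
    and S: "\<And>i. i < n \<Longrightarrow> (\<Sum>j<n. (expectation (\<lambda>\<omega>. X i \<omega> * X j \<omega>))\<^sup>2) \<le> S"
  shows "integrable M (\<lambda>\<omega>. ((\<Sum>i<n. X i \<omega> ^ 4) - 3 * real n * v\<^sup>2)\<^sup>2)"
    and "expectation (\<lambda>\<omega>. ((\<Sum>i<n. X i \<omega> ^ 4) - 3 * real n * v\<^sup>2)\<^sup>2) \<le> 96 * v\<^sup>2 * n * S"
proof -
  define D where "D i j = (\<lambda>\<omega>. (X i \<omega> ^ 4 - 3 * v\<^sup>2) * (X j \<omega> ^ 4 - 3 * v\<^sup>2))" for i j
  define r where "r i j = expectation (\<lambda>\<omega>. X i \<omega> * X j \<omega>)" for i j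
  have G: "centered_gaussian M (X i)" if "i < n" for i
    using jointly_centered_gaussianD(2)[OF J[OF that that]] .
  have sq: "((\<Sum>i<n. X i \<omega> ^ 4) - 3 * real n * v\<^sup>2)\<^sup>2 = (\<Sum>i<n. \<Sum>j<n. D i j \<omega>)" for \<omega>
  proof -
    have "(\<Sum>i<n. X i \<omega> ^ 4) - 3 * real n * v\<^sup>2 = (\<Sum>i<n. X i \<omega> ^ 4 - 3 * v\<^sup>2)"
      by (simp add: sum_subtractf)
    then show ?thesis
      by (simp add: power2_eq_square sum_product D_def)
  qed
  have D: "integrable M (D i j) \<and> expectation (D i j) \<le> 96 * v\<^sup>2 * (r i j)\<^sup>2"
    if ij: "i < n" "j < n" for i j
  proof -
    have int: "integrable M (\<lambda>\<omega>. X i \<omega> ^ k * X j \<omega> ^ l)" for k l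
      by (rule centered_gaussian_integrable_mult[OF G[OF ij(1)] G[OF ij(2)]])
    note int' = int[of 4 4] int[of 4 0, simplified] int[of 0 4, simplified] int[of 1 1, simplified]
      int[of 2 0, simplified] int[of 0 2, simplified]
    have D_eq: "D i j = (\<lambda>\<omega>. X i \<omega> ^ 4 * X j \<omega> ^ 4 - 3 * v\<^sup>2 * X i \<omega> ^ 4 - 3 * v\<^sup>2 * X j \<omega> ^ 4 + 9 * v ^ 4)"
      by (auto simp: D_def algebra_simps power2_eq_square power4_eq_xxxx)
    have four: "expectation (\<lambda>\<omega>. X k \<omega> ^ 4) = 3 * v\<^sup>2" if "k < n" for k
      using centered_gaussian_fourth_moment[OF G[OF that]] v[OF that] by simp
    have "expectation (\<lambda>\<omega>. X i \<omega> ^ 4 * X j \<omega> ^ 4) = 9 * v ^ 4 + 72 * v\<^sup>2 * (r i j)\<^sup>2 + 24 * r i j ^ 4"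
      using jointly_gaussian_fourth_powers[OF J[OF ij]] v[OF ij(1)] v[OF ij(2)]
      by (simp add: r_def power2_eq_square power4_eq_xxxx)
    then have "expectation (D i j) = 72 * v\<^sup>2 * (r i j)\<^sup>2 + 24 * r i j ^ 4"
      unfolding D_eq
      by (simp add: int' four ij prob_space)
    moreover have "(r i j)\<^sup>2 \<le> v\<^sup>2"
    proof -
      have eq: "(\<lambda>\<omega>. (X i \<omega> + c * X j \<omega>)\<^sup>2) = (\<lambda>\<omega>. (X i \<omega>)\<^sup>2 + 2 * c * (X i \<omega> * X j \<omega>) + c\<^sup>2 * (X j \<omega>)\<^sup>2)" for c
        by (auto simp: power2_eq_square algebra_simps)
      \<comment> \<open>Cauchy-Schwarz from the second moments of the sum and the difference: both
        variances equal \<open>v\<close>, so \<open>c = 1\<close> and \<open>c = -1\<close>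
        suffice.\<close>
      have "0 \<le> v + 2 * c * r i j + c\<^sup>2 * v" for c
      proof -
        have "0 \<le> expectation (\<lambda>\<omega>. (X i \<omega> + c * X j \<omega>)\<^sup>2)" by simp
        then show ?thesis unfolding eq by (simp add: int' v ij r_def)
      qed
      from this[of 1] this[of "-1"] have "\<bar>r i j\<bar> \<le> v" by auto
      then show ?thesis unfolding abs_le_square_iff[symmetric] by simp
    qed
    \<comment> \<open>This absorbs \<open>24 r^4\<close> into \<open>24 v^2 r^2\<close>, whence 96 =
      72 + 24.\<close>
    then have "(r i j)\<^sup>2 * (r i j)\<^sup>2 \<le> v\<^sup>2 * (r i j)\<^sup>2" by (rule mult_right_mono) simp
    ultimately show ?thesis
      using int' by (simp add: D_eq power4_eq_xxxx power2_eq_square)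
  qed
  show "integrable M (\<lambda>\<omega>. ((\<Sum>i<n. X i \<omega> ^ 4) - 3 * real n * v\<^sup>2)\<^sup>2)"
    unfolding sq using D by (intro Bochner_Integration.integrable_sum) auto
  have "expectation (\<lambda>\<omega>. ((\<Sum>i<n. X i \<omega> ^ 4) - 3 * real n * v\<^sup>2)\<^sup>2) = (\<Sum>i<n. expectation (\<lambda>\<omega>. \<Sum>j<n. D i j \<omega>))"
    unfolding sq using D
    by (intro Bochner_Integration.integral_sum Bochner_Integration.integrable_sum) auto
  also have "\<dots> = (\<Sum>i<n. \<Sum>j<n. expectation (D i j))"
    using D by (intro sum.cong refl Bochner_Integration.integral_sum) auto
  also have "\<dots> \<le> (\<Sum>i<n. \<Sum>j<n. 96 * v\<^sup>2 * (r i j)\<^sup>2)"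
    using D by (intro sum_mono) auto
  also have "\<dots> = (\<Sum>i<n. 96 * v\<^sup>2 * (\<Sum>j<n. (r i j)\<^sup>2))"
    by (simp add: sum_distrib_left)
  also have "\<dots> \<le> (\<Sum>i<n. 96 * v\<^sup>2 * S)"
    using S by (intro sum_mono mult_left_mono) (auto simp: r_def)
  finally show "expectation (\<lambda>\<omega>. ((\<Sum>i<n. X i \<omega> ^ 4) - 3 * real n * v\<^sup>2)\<^sup>2) \<le> 96 * v\<^sup>2 * n * S"
    by (simp add: algebra_simps)
qed

section \<open>Almost sure convergence from summable expectations\<close>

text \<open>By monotone convergence the series of the \<open>Z k\<close> has finite expectation, so
  it converges almost surely and its terms tend to 0. This takes the place of Chebyshev with
  Borel-Cantelli.\<close>

lemma AE_tendsto_0_of_summable_expectation: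
  fixes Z :: "nat \<Rightarrow> 'a \<Rightarrow> real"
  assumes int: "\<And>k. integrable M (Z k)" and nn: "\<And>k \<omega>. 0 \<le> Z k \<omega>"
    and le: "\<And>k. expectation (Z k) \<le> c k" and sm: "summable c"
  shows "AE \<omega> in M. (\<lambda>k. Z k \<omega>) \<longlonglongrightarrow> 0"
proof -
  have [measurable]: "Z k \<in> borel_measurable M" for k using int by auto
  have c: "0 \<le> c k" for k
  proof -
    have "0 \<le> expectation (Z k)" using nn by (intro integral_nonneg_AE) auto
    then show ?thesis using le[of k] by simp
  qed
  have "(\<integral>\<^sup>+ \<omega>. (\<Sum>k. ennreal (Z k \<omega>)) \<partial>M) = (\<Sum>k. \<integral>\<^sup>+ \<omega>. ennreal (Z k \<omega>) \<partial>M)"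
    by (rule nn_integral_suminf) measurable
  also have "\<dots> \<le> (\<Sum>k. ennreal (c k))"
    using le int nn by (intro suminf_le) (auto simp: nn_integral_eq_integral ennreal_leI)
  also have "\<dots> = ennreal (\<Sum>k. c k)"
    using c sm by (rule suminf_ennreal2)
  finally have "(\<integral>\<^sup>+ \<omega>. (\<Sum>k. ennreal (Z k \<omega>)) \<partial>M) \<noteq> \<infinity>"
    by (metis ennreal_neq_top infinity_ennreal_def neq_top_trans)
  then have "AE \<omega> in M. (\<Sum>k. ennreal (Z k \<omega>)) \<noteq> \<infinity>"
    by (intro nn_integral_PInf_AE) measurable
  then show ?thesis
  proof eventually_elim
    case (elim \<omega>)
    then have "summable (\<lambda>k. Z k \<omega>)"
      using nn by (intro summable_suminf_not_top) auto
    then show ?case by (rule summable_LIMSEQ_zero)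
  qed
qed

end

section \<open>Fractional Gaussian noise\<close>

text \<open>Two applications of the mean value theorem turn the second difference into
  \<open>p (p - 1) w powr (p - 2)\<close> with \<open>w > x - 1\<close>. The exponent is negative,
  so replacing \<open>w\<close> by \<open>x - 1\<close> only enlarges it.\<close>

lemma second_difference_powr_bound:
  fixes p :: real
  assumes p: "1 < p" "p < 2" and x: "1 < x"
  shows "0 \<le> (x + 1) powr p + (x - 1) powr p - 2 * x powr p"
    and "(x + 1) powr p + (x - 1) powr p - 2 * x powr p \<le> p * (p - 1) * (x - 1) powr (p - 2)"
proof -
  define h where "h y = (y + 1) powr p - y powr p" for y
  \<comment> \<open>The second difference of the power is the first difference of \<open>h\<close>;
    \<open>x > 1\<close> keeps the interval inside the positive axis, where \<open>powr\<close> is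
    differentiable.\<close>
  have "\<exists>z>x - 1. z < x \<and> h x - h (x - 1) = (x - (x - 1)) * (p * (z + 1) powr (p - 1) - p * z powr (p - 1))"
    using x unfolding h_def
    by (intro MVT2) (auto intro!: derivative_eq_intros)
  then obtain z where z: "x - 1 < z" "z < x"
    "h x - h (x - 1) = p * (z + 1) powr (p - 1) - p * z powr (p - 1)" by auto
  have "\<exists>w>z. w < z + 1 \<and> (z + 1) powr (p - 1) - z powr (p - 1) = ((z + 1) - z) * ((p - 1) * w powr (p - 2))"
    using x z(1) by (intro MVT2) (auto intro!: derivative_eq_intros)
  then obtain w where w: "z < w" "(z + 1) powr (p - 1) - z powr (p - 1) = (p - 1) * w powr (p - 2)"
    by auto
  have "h x - h (x - 1) = p * ((z + 1) powr (p - 1) - z powr (p - 1))"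
    using z(3) by (simp add: right_diff_distrib)
  then have "h x - h (x - 1) = p * (p - 1) * w powr (p - 2)"
    unfolding w(2) by simp
  then have eq: "(x + 1) powr p + (x - 1) powr p - 2 * x powr p = p * (p - 1) * w powr (p - 2)"
    by (simp add: h_def)
  show "0 \<le> (x + 1) powr p + (x - 1) powr p - 2 * x powr p"
    unfolding eq using p by simp
  have "w powr (p - 2) \<le> (x - 1) powr (p - 2)"
    using p x z w by (intro powr_mono2') auto
  then show "(x + 1) powr p + (x - 1) powr p - 2 * x powr p \<le> p * (p - 1) * (x - 1) powr (p - 2)"
    unfolding eq using p by (intro mult_left_mono) auto
qed

text \<open>Autocovariance of fractional Gaussian noise at lag \<open>x\<close>.\<close>

definition fgn_cov :: "real \<Rightarrow> real \<Rightarrow> real" where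
  "fgn_cov H x = (\<bar>x + 1\<bar> powr (2 * H) + \<bar>x - 1\<bar> powr (2 * H) - 2 * \<bar>x\<bar> powr (2 * H)) / 2"

lemma fgn_cov_minus: "fgn_cov H (- x) = fgn_cov H x"
  by (simp add: fgn_cov_def abs_minus_commute add.commute)

text \<open>The autocovariance at lag \<open>k\<close> is of order
  \<open>k powr (2 * H - 2)\<close>; its square has exponent \<open>4 * H - 4\<close>, which is
  below -1 precisely when \<open>H < 3/4\<close>.\<close>

lemma summable_fgn_cov_squared:
  assumes H: "1/2 < H" "H < 3/4"
  shows "summable (\<lambda>k::nat. (fgn_cov H (real k))\<^sup>2)"
proof -
  \<comment> \<open>Half of \<open>p * (p - 1)\<close> at \<open>p = 2 * H\<close>.\<close>
  define C where "C = H * (2 * H - 1)"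
  have "summable (\<lambda>k. C\<^sup>2 * real (Suc k) powr (4 * H - 4))"
    using summable_ignore_initial_segment[of "\<lambda>k. real k powr (4 * H - 4)" 1] H
    by (intro summable_mult) (simp add: summable_real_powr_iff)
  \<comment> \<open>Lags 0 and 1 are set aside because the second difference bound requires
    \<open>x > 1\<close>.\<close>
  then have "summable (\<lambda>k. (fgn_cov H (real (k + 2)))\<^sup>2)"
  proof (rule summable_comparison_test'[where N = 0])
    fix k :: nat
    have "0 \<le> fgn_cov H (k + 2)" "fgn_cov H (k + 2) \<le> C * real (Suc k) powr (2 * H - 2)"
      using second_difference_powr_bound[of "2 * H" "real (k + 2)"] H
      by (auto simp: fgn_cov_def C_def add_ac)
    then have "(fgn_cov H (k + 2))\<^sup>2 \<le> (C * real (Suc k) powr (2 * H - 2))\<^sup>2"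
      by (intro power_mono) auto
    also have "\<dots> = C\<^sup>2 * real (Suc k) powr (4 * H - 4)"
      by (simp add: power_mult_distrib power2_eq_square flip: powr_add)
    finally show "norm ((fgn_cov H (real (k + 2)))\<^sup>2) \<le> C\<^sup>2 * real (Suc k) powr (4 * H - 4)" by simp
  qed
  then show ?thesis by (rule summable_iff_shift[THEN iffD1])
qed

text \<open>The indices up to \<open>i\<close> and those beyond \<open>i\<close> each map
  injectively to lags, so each half is at most the full series. The bound is uniform in
  \<open>i\<close> and \<open>n\<close>.\<close>

lemma sum_fgn_cov_squared_le:
  assumes H: "1/2 < H" "H < 3/4"
  shows "(\<Sum>j<n. (fgn_cov H (real i - real j))\<^sup>2) \<le> 2 * (\<Sum>k. (fgn_cov H (real k))\<^sup>2)"
proof -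
  let ?g = "\<lambda>k::nat. (fgn_cov H (real k))\<^sup>2"
  have part: "sum ?g A \<le> suminf ?g" if "finite A" for A
    using summable_fgn_cov_squared[OF H] that by (intro sum_le_suminf) auto
  have "(\<Sum>j<n. (fgn_cov H (real i - real j))\<^sup>2)
    = (\<Sum>j\<in>{..<n} \<inter> {..i}. (fgn_cov H (real i - real j))\<^sup>2) + (\<Sum>j\<in>{..<n} - {..i}. (fgn_cov H (real i - real j))\<^sup>2)"
    by (simp add: sum.Int_Diff)
  also have "(\<Sum>j\<in>{..<n} \<inter> {..i}. (fgn_cov H (real i - real j))\<^sup>2) = sum ?g ((\<lambda>j. i - j) ` ({..<n} \<inter> {..i}))"
    by (subst sum.reindex) (auto simp: inj_on_def of_nat_diff intro!: sum.cong)
  also have "(\<Sum>j\<in>{..<n} - {..i}. (fgn_cov H (real i - real j))\<^sup>2) = sum ?g ((\<lambda>j. j - i) ` ({..<n} - {..i}))"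
  proof (subst sum.reindex)
    show "inj_on (\<lambda>j. j - i) ({..<n} - {..i})" by (auto simp: inj_on_def)
    show "(\<Sum>j\<in>{..<n} - {..i}. (fgn_cov H (real i - real j))\<^sup>2) = sum (?g \<circ> (\<lambda>j. j - i)) ({..<n} - {..i})"
      using fgn_cov_minus[of H "real j - real i" for j]
      by (intro sum.cong) (auto simp: of_nat_diff)
  qed
  also have "sum ?g ((\<lambda>j. i - j) ` ({..<n} \<inter> {..i})) + sum ?g ((\<lambda>j. j - i) ` ({..<n} - {..i})) \<le> suminf ?g + suminf ?g"
    by (intro add_mono part) auto
  finally show ?thesis by simp
qed

section \<open>Increments of the mixed model\<close>

lemma grid_point_in_interval:
  assumes "T > 0" "n > 0" "i \<le> n"
  shows "T * real i / real n \<in> {0..T}"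
  using assms by (simp add: field_simps)

lemma grid_endpoints_in_interval:
  assumes "T > 0" "i < n"
  shows "T * real i / real n \<in> {0..T}" "T * (real i + 1) / real n \<in> {0..T}"
  using assms grid_point_in_interval[of T n i] grid_point_in_interval[of T n "Suc i"]
  by (auto simp: add.commute)

lemma increment_mixed_model:
  "increment T (\<lambda>t. mixed_model a b B W t \<omega>) n i =
    a * increment T (\<lambda>t. B t \<omega>) n i + b * increment T (\<lambda>t. W t \<omega>) n i"
  by (simp add: increment_def mixed_model_def algebra_simps)

context prob_space
begin

section \<open>Covariance structure of the increments of both components\<close>

lemma fbm_linear_combination:
  assumes B: "fractional_brownian_motion M I H B" and J: "finite J" "J \<subseteq> I"
  shows "centered_gaussian M (\<lambda>\<omega>. \<Sum>t\<in>J. c t * B t \<omega>)"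
proof -
  have *: "gaussian_rv M (\<lambda>\<omega>. \<Sum>t\<in>J. c t * B t \<omega>)" if "finite J" "J \<subseteq> I" for J c
    using B that by (simp add: fractional_brownian_motion_def gaussian_process_def)
  have "centered_gaussian M (B t)" if "t \<in> I" for t
    using *[of "{t}" "\<lambda>_. 1"] B that by (simp add: centered_gaussian_def fractional_brownian_motion_def)
  then have "integrable M (B t) \<and> expectation (B t) = 0" if "t \<in> J" for t
    using J that centered_gaussian_integrable by (auto simp: centered_gaussian_def)
  then have "expectation (\<lambda>\<omega>. \<Sum>t\<in>J. c t * B t \<omega>) = 0"
    by (subst Bochner_Integration.integral_sum) auto
  then show ?thesis using *[OF J] by (simp add: centered_gaussian_def)
qed

lemma fbm_increments_jointly_gaussian:
  assumes B: "fractional_brownian_motion M I H B" and I: "s \<in> I" "t \<in> I" "u \<in> I" "v \<in> I"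
  shows "jointly_centered_gaussian (\<lambda>\<omega>. B t \<omega> - B s \<omega>) (\<lambda>\<omega>. B v \<omega> - B u \<omega>)"
  unfolding jointly_centered_gaussian_def
proof (intro allI)
  fix \<alpha> \<beta> :: real
  let ?J = "{s, t, u, v}"
  \<comment> \<open>The four times may coincide, as for neighbouring or equal increments; summing
    indicators adds up the coefficients at a repeated time.\<close>
  define c where "c x = \<alpha> * ((if x = t then 1 else 0) - (if x = s then 1 else 0)) +
      \<beta> * ((if x = v then 1 else 0) - (if x = u then 1 else 0))" for x
  have c_eq: "c x * y = (if x = t then \<alpha> * y else 0) - (if x = s then \<alpha> * y else 0) +
      (if x = v then \<beta> * y else 0) - (if x = u then \<beta> * y else 0)" for x y
    by (simp add: c_def algebra_simps)
  have "centered_gaussian M (\<lambda>\<omega>. \<Sum>x\<in>?J. c x * B x \<omega>)"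
    using I by (intro fbm_linear_combination[OF B]) auto
  also have "(\<lambda>\<omega>. \<Sum>x\<in>?J. c x * B x \<omega>) = (\<lambda>\<omega>. \<alpha> * (B t \<omega> - B s \<omega>) + \<beta> * (B v \<omega> - B u \<omega>))"
    unfolding c_eq by (simp only: sum.distrib sum_subtractf sum.delta finite.intros)
      (auto simp: algebra_simps)
  finally show "centered_gaussian M (\<lambda>\<omega>. \<alpha> * (B t \<omega> - B s \<omega>) + \<beta> * (B v \<omega> - B u \<omega>))" .
qed

text \<open>The terms in a single time cancel in the bilinear expansion, leaving only time
  differences: this is the stationarity of the increments.\<close>

lemma fbm_increment_covariance:
  assumes B: "fractional_brownian_motion M I H B" and I: "s \<in> I" "t \<in> I" "u \<in> I" "v \<in> I"
  shows "expectation (\<lambda>\<omega>. (B t \<omega> - B s \<omega>) * (B v \<omega> - B u \<omega>)) =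
    1/2 * (\<bar>t - u\<bar> powr (2*H) + \<bar>s - v\<bar> powr (2*H) - \<bar>t - v\<bar> powr (2*H) - \<bar>s - u\<bar> powr (2*H))"
proof -
  have G: "centered_gaussian M (B t)" if "t \<in> I" for t
    using fbm_linear_combination[OF B, of "{t}" "\<lambda>_. 1"] that by simp
  have int: "integrable M (\<lambda>\<omega>. B t \<omega> * B s \<omega>)" if "t \<in> I" "s \<in> I" for s t
    using centered_gaussian_integrable_mult[OF G[OF that(1)] G[OF that(2)], of 1 1] by simp
  have cov: "expectation (\<lambda>\<omega>. B t \<omega> * B s \<omega>) =
        1/2 * (t powr (2*H) + s powr (2*H) - \<bar>t - s\<bar> powr (2*H))" if "t \<in> I" "s \<in> I" for s t
    using B that by (simp add: fractional_brownian_motion_def)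
  have "(\<lambda>\<omega>. (B t \<omega> - B s \<omega>) * (B v \<omega> - B u \<omega>)) =
     (\<lambda>\<omega>. B t \<omega> * B v \<omega> - B t \<omega> * B u \<omega> - B s \<omega> * B v \<omega> + B s \<omega> * B u \<omega>)"
    by (auto simp: algebra_simps)
  then show ?thesis using I by (simp add: int cov algebra_simps)
qed

text \<open>Self-similarity: the mesh width factors out with exponent \<open>2 * H\<close>, and what
  remains depends on the lag alone.\<close>

lemma fbm_grid_increments:
  assumes B: "fractional_brownian_motion M {0..T} H B" and T: "T > 0" and ij: "i < n" "j < n"
  defines "X \<equiv> \<lambda>i \<omega>. increment T (\<lambda>t. B t \<omega>) n i"
  shows "jointly_centered_gaussian (X i) (X j)"
    and "expectation (\<lambda>\<omega>. X i \<omega> * X j \<omega>) = (T / n) powr (2 * H) * fgn_cov H (real i - real j)"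
proof -
  note I = grid_endpoints_in_interval[OF T ij(1)] grid_endpoints_in_interval[OF T ij(2)]
  show "jointly_centered_gaussian (X i) (X j)"
    unfolding X_def increment_def by (rule fbm_increments_jointly_gaussian[OF B I])
  define d where "d = T / n"
  have d: "d > 0" using T ij by (simp add: d_def)
  have *: "\<bar>d * x\<bar> powr (2 * H) = d powr (2 * H) * \<bar>x\<bar> powr (2 * H)" for x
    using d by (simp add: abs_mult powr_mult)
  have "T * (real i + 1) / n - T * real j / n = d * ((real i - real j) + 1)"
    "T * real i / n - T * (real j + 1) / n = d * ((real i - real j) - 1)"
    "T * (real i + 1) / n - T * (real j + 1) / n = d * (real i - real j)"
    "T * real i / n - T * real j / n = d * (real i - real j)"
    by (simp_all add: d_def distrib_left right_diff_distrib add_divide_distrib diff_divide_distrib)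
  then show "expectation (\<lambda>\<omega>. X i \<omega> * X j \<omega>) = (T / n) powr (2 * H) * fgn_cov H (real i - real j)"
    unfolding X_def increment_def fbm_increment_covariance[OF B I]
    by (simp add: * fgn_cov_def flip: d_def) (simp add: algebra_simps)
qed

lemma indep_vars_imp_indep_var:
  assumes "indep_vars (\<lambda>_. N) X I" and "i \<in> I" "j \<in> I" "i \<noteq> j"
  shows "indep_var N (X i) N (X j)"
proof -
  \<comment> \<open>Restrictions of the family to the disjoint sets \<open>{i}\<close> and
    \<open>{j}\<close> are independent; evaluation recovers the single variables.\<close>
  have "indep_var N ((\<lambda>f. f i) \<circ> (\<lambda>\<omega>. \<lambda>k\<in>{i}. X k \<omega>)) N ((\<lambda>f. f j) \<circ> (\<lambda>\<omega>. \<lambda>k\<in>{j}. X k \<omega>))"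
    using assms by (intro indep_var_compose[OF indep_var_restrict[OF assms(1)]]) auto
  then show ?thesis by (simp add: comp_def)
qed

text \<open>Joint normality is assembled from independent normal increments: for
  \<open>i = j\<close> the combination is a multiple of one variable, otherwise a sum of two
  independent ones.\<close>

lemma wiener_grid_increments:
  assumes W: "wiener_process M {0..T} W" and T: "T > 0" and ij: "i < n" "j < n"
  defines "X \<equiv> \<lambda>i \<omega>. increment T (\<lambda>t. W t \<omega>) n i"
  shows "jointly_centered_gaussian (X i) (X j)"
    and "expectation (\<lambda>\<omega>. X i \<omega> * X j \<omega>) = (if i = j then T / n else 0)"
proof -
  have N: "distributed M lborel (X k) (normal_density 0 (sqrt (T / n)))" if "k < n" for k
  proof -
    have "T * real k / n < T * (real k + 1) / n" using T that by (simp add: divide_strict_right_mono)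
    then have "distributed M lborel (\<lambda>\<omega>. W (T * (real k + 1) / n) \<omega> - W (T * real k / n) \<omega>)
        (normal_density 0 (sqrt (T * (real k + 1) / n - T * real k / n)))"
      using W grid_endpoints_in_interval[OF T that] unfolding wiener_process_def by blast
    moreover have "T * (real k + 1) / n - T * real k / n = T / n"
      by (simp add: distrib_left add_divide_distrib)
    ultimately show ?thesis unfolding X_def increment_def by simp
  qed
  have s: "sqrt (T / n) > 0" using T ij by simp
  have meas: "X k \<in> borel_measurable M" if "k < n" for k
    using distributed_measurable[OF N[OF that]] by simp
  have G: "centered_gaussian M (X k)" if "k < n" for k
    using N[OF that] s meas[OF that] normal_distributed_expectation[OF s N[OF that]]
    unfolding centered_gaussian_def gaussian_rv_def by blast
  have var: "expectation (\<lambda>\<omega>. (X k \<omega>)\<^sup>2) = T / n" if "k < n" for k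
    using normal_distributed_variance[OF s N[OF that]] normal_distributed_expectation[OF s N[OF that]] s
    by simp
  have indep: "indep_var borel (X i) borel (X j)" if "i \<noteq> j"
  proof -
    define \<tau> where "\<tau> k = T * real k / n" for k :: nat
    have "mono_on {..n} \<tau>" "\<tau> ` {..n} \<subseteq> {0..T}"
      using T ij grid_point_in_interval[OF T, of n]
      by (auto simp: \<tau>_def mono_on_def intro!: divide_right_mono)
    then have "indep_vars (\<lambda>_. borel) (\<lambda>i \<omega>. W (\<tau> (Suc i)) \<omega> - W (\<tau> i) \<omega>) {..<n}"
      using W unfolding wiener_process_def by blast
    then have "indep_vars (\<lambda>_. borel) X {..<n}"
      by (simp add: X_def increment_def \<tau>_def add.commute)
    then show ?thesis using ij that by (intro indep_vars_imp_indep_var) auto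
  qed
  show "jointly_centered_gaussian (X i) (X j)"
    unfolding jointly_centered_gaussian_def
  proof (intro allI)
    fix s t :: real
    show "centered_gaussian M (\<lambda>\<omega>. s * X i \<omega> + t * X j \<omega>)"
    proof (cases "i = j")
      case True
      then show ?thesis using centered_gaussian_scale[OF G[OF ij(1)], of "s + t"]
        by (simp add: distrib_right)
    next
      case False
      have "indep_var borel ((\<lambda>x. s * x) \<circ> X i) borel ((\<lambda>x. t * x) \<circ> X j)"
        by (rule indep_var_compose[OF indep[OF False]]) auto
      then show ?thesis
        using G ij by (intro centered_gaussian_add_indep centered_gaussian_scale) (auto simp: comp_def)
    qed
  qed
  show "expectation (\<lambda>\<omega>. X i \<omega> * X j \<omega>) = (if i = j then T / n else 0)"
  proof (cases "i = j")
    case True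
    then show ?thesis using var[OF ij(1)] by (simp add: power2_eq_square)
  next
    case False
    have "expectation (\<lambda>\<omega>. X i \<omega> * X j \<omega>) = expectation (X i) * expectation (X j)"
      using G ij by (intro indep_var_lebesgue_integral indep[OF False] centered_gaussian_integrable)
    then show ?thesis using G[OF ij(1)] False by (simp add: centered_gaussian_def)
  qed
qed

text \<open>Grid increments are measurable functions of finitely many coordinates of a path, so
  independence of the paths passes to combinations of increments.\<close>

lemma independent_processes_increments:
  assumes BW: "independent_processes M {0..T} B W" and T: "T > 0"
    and ij: "i < n" "j < n" "k < n" "l < n"
  shows "indep_var borel (\<lambda>\<omega>. s * increment T (\<lambda>t. B t \<omega>) n i + t * increment T (\<lambda>t. B t \<omega>) n j)
    borel (\<lambda>\<omega>. u * increment T (\<lambda>t. W t \<omega>) n k + v * increment T (\<lambda>t. W t \<omega>) n l)"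
proof -
  have meas: "(\<lambda>x. increment T x n i) \<in> borel_measurable (Pi\<^sub>M {0..T} (\<lambda>_. borel))" if "i < n" for i
    unfolding increment_def using grid_endpoints_in_interval[OF T that]
    by (intro borel_measurable_diff measurable_component_singleton) auto
  \<comment> \<open>The product space holds paths restricted to \<open>{0..T}\<close>, undefined
    elsewhere; the grid points lie inside, so restriction leaves increments unchanged.\<close>
  have res: "increment T (\<lambda>t\<in>{0..T}. X t \<omega>) n i = increment T (\<lambda>t. X t \<omega>) n i"
    if "i < n" for X :: "real \<Rightarrow> 'a \<Rightarrow> real" and i \<omega>
    unfolding increment_def using grid_endpoints_in_interval[OF T that] by simp
  have "indep_var borel ((\<lambda>x. s * increment T x n i + t * increment T x n j) \<circ> (\<lambda>\<omega>. \<lambda>t\<in>{0..T}. B t \<omega>))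
    borel ((\<lambda>x. u * increment T x n k + v * increment T x n l) \<circ> (\<lambda>\<omega>. \<lambda>t\<in>{0..T}. W t \<omega>))"
    using BW ij unfolding independent_processes_def
    by (intro indep_var_compose[where ?M1.0 = "Pi\<^sub>M {0..T} (\<lambda>_. borel)" and ?M2.0 = "Pi\<^sub>M {0..T} (\<lambda>_. borel)"]
        borel_measurable_add borel_measurable_times borel_measurable_const meas)
  then show ?thesis by (simp only: comp_def res ij)
qed

lemma mixed_grid_increments:
  fixes a b :: real
  assumes B: "fractional_brownian_motion M {0..T} H B" and W: "wiener_process M {0..T} W"
    and BW: "independent_processes M {0..T} B W" and T: "T > 0" and ij: "i < n" "j < n"
  defines "X \<equiv> \<lambda>i \<omega>. increment T (\<lambda>t. mixed_model a b B W t \<omega>) n i"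
  shows "jointly_centered_gaussian (X i) (X j)"
    and "expectation (\<lambda>\<omega>. X i \<omega> * X j \<omega>) =
      a\<^sup>2 * (T / n) powr (2 * H) * fgn_cov H (real i - real j) + b\<^sup>2 * (if i = j then T / n else 0)"
proof -
  define P where "P i \<omega> = increment T (\<lambda>t. B t \<omega>) n i" for i \<omega>
  define Q where "Q i \<omega> = increment T (\<lambda>t. W t \<omega>) n i" for i \<omega>
  note [folded P_def Q_def] = fbm_grid_increments[OF B T ij] wiener_grid_increments[OF W T ij]
  note P = this(1,2) and Q = this(3,4)
  have indep: "indep_var borel (\<lambda>\<omega>. s * P i \<omega> + t * P j \<omega>) borel (\<lambda>\<omega>. u * Q k \<omega> + v * Q l \<omega>)"
    if "i < n" "j < n" "k < n" "l < n" for i j k l s t u v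
    unfolding P_def Q_def by (rule independent_processes_increments[OF BW T that])
  have X: "X i \<omega> = a * P i \<omega> + b * Q i \<omega>" for i \<omega>
    by (simp add: X_def P_def Q_def increment_mixed_model)
  show "jointly_centered_gaussian (X i) (X j)"
    unfolding jointly_centered_gaussian_def
  proof (intro allI)
    fix s t
    \<comment> \<open>Grouping by process instead of by index yields two independent Gaussian
      summands.\<close>
    have "centered_gaussian M (\<lambda>\<omega>. ((s * a) * P i \<omega> + (t * a) * P j \<omega>) + ((s * b) * Q i \<omega> + (t * b) * Q j \<omega>))"
      by (intro centered_gaussian_add_indep jointly_centered_gaussianD P Q indep ij)
    then show "centered_gaussian M (\<lambda>\<omega>. s * X i \<omega> + t * X j \<omega>)"
      by (simp add: X algebra_simps)
  qed
  note P' = jointly_centered_gaussianD(2,3)[OF P(1)] and Q' = jointly_centered_gaussianD(2,3)[OF Q(1)]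
  have int: "integrable M (\<lambda>\<omega>. Y \<omega> * Z \<omega>)" if "centered_gaussian M Y" "centered_gaussian M Z" for Y Z
    using centered_gaussian_integrable_mult[OF that, of 1 1] by simp
  have zero: "expectation (\<lambda>\<omega>. P i \<omega> * Q j \<omega>) = 0" if "i < n" "j < n"
    "centered_gaussian M (P i)" "centered_gaussian M (Q j)" for i j
  proof -
    \<comment> \<open>The coefficients 1, 0, 1, 0 extract single increments from the independent
      pairs of combinations.\<close>
    have "expectation (\<lambda>\<omega>. P i \<omega> * Q j \<omega>) = expectation (P i) * expectation (Q j)"
      using indep[of i i j j 1 0 1 0] that
      by (intro indep_var_lebesgue_integral centered_gaussian_integrable) auto
    then show ?thesis using that by (simp add: centered_gaussian_def)
  qed
  have "(\<lambda>\<omega>. X i \<omega> * X j \<omega>) = (\<lambda>\<omega>. a\<^sup>2 * (P i \<omega> * P j \<omega>) + a * b * (P i \<omega> * Q j \<omega>)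
      + a * b * (P j \<omega> * Q i \<omega>) + b\<^sup>2 * (Q i \<omega> * Q j \<omega>))"
    by (auto simp: X power2_eq_square algebra_simps)
  then have "expectation (\<lambda>\<omega>. X i \<omega> * X j \<omega>) =
      a\<^sup>2 * expectation (\<lambda>\<omega>. P i \<omega> * P j \<omega>) + b\<^sup>2 * expectation (\<lambda>\<omega>. Q i \<omega> * Q j \<omega>)"
    by (simp add: int P' Q' zero ij)
  then show "expectation (\<lambda>\<omega>. X i \<omega> * X j \<omega>) =
      a\<^sup>2 * (T / n) powr (2 * H) * fgn_cov H (real i - real j) + b\<^sup>2 * (if i = j then T / n else 0)"
    by (simp only: P(2) Q(2) mult.assoc)
qed

section \<open>Concentration of the quartic variation\<close>

text \<open>The variance \<open>v\<close> of an increment is of order \<open>1/n\<close> and each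
  row of squared covariances is of order \<open>1/n^2\<close>, so \<open>96 v^2 n S\<close> is of
  order \<open>1/n^3\<close>.\<close>

lemma mixed_quartic_variation_deviation:
  assumes B: "fractional_brownian_motion M {0..T} H B" and W: "wiener_process M {0..T} W"
    and BW: "independent_processes M {0..T} B W" and T: "T > 0" and H: "1/2 < H" "H < 3/4"
  obtains K where
    "\<And>n. n > 0 \<Longrightarrow> integrable M (\<lambda>\<omega>. (quartic_variation T (\<lambda>t. mixed_model a b B W t \<omega>) n
      - 3 * real n * (a\<^sup>2 * (T / n) powr (2 * H) + b\<^sup>2 * (T / n))\<^sup>2)\<^sup>2)"
    "\<And>n. n > 0 \<Longrightarrow> expectation (\<lambda>\<omega>. (quartic_variation T (\<lambda>t. mixed_model a b B W t \<omega>) n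
      - 3 * real n * (a\<^sup>2 * (T / n) powr (2 * H) + b\<^sup>2 * (T / n))\<^sup>2)\<^sup>2) \<le> K / real n ^ 3"
proof -
  define G where "G = (\<Sum>k. (fgn_cov H (real k))\<^sup>2)"
  define C1 where "C1 = a\<^sup>2 * T powr (2 * H) + b\<^sup>2 * T"
  define C2 where "C2 = 4 * (a\<^sup>2 * T powr (2 * H))\<^sup>2 * G + 2 * (b\<^sup>2 * T)\<^sup>2"
  have G: "G \<ge> 0" unfolding G_def by (intro suminf_nonneg summable_fgn_cov_squared H) auto
  have C2: "C2 \<ge> 0" using G by (simp add: C2_def)
  have main: "integrable M (\<lambda>\<omega>. (quartic_variation T (\<lambda>t. mixed_model a b B W t \<omega>) n
      - 3 * real n * (a\<^sup>2 * (T / n) powr (2 * H) + b\<^sup>2 * (T / n))\<^sup>2)\<^sup>2) \<and>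
    expectation (\<lambda>\<omega>. (quartic_variation T (\<lambda>t. mixed_model a b B W t \<omega>) n
      - 3 * real n * (a\<^sup>2 * (T / n) powr (2 * H) + b\<^sup>2 * (T / n))\<^sup>2)\<^sup>2) \<le> 96 * C1\<^sup>2 * C2 / real n ^ 3"
    if n: "n > 0" for n
  proof -
    define X where "X i \<omega> = increment T (\<lambda>t. mixed_model a b B W t \<omega>) n i" for i \<omega>
    define d where "d = T / n"
    define p where "p = a\<^sup>2 * d powr (2 * H)"
    define q where "q = b\<^sup>2 * d"
    define v where "v = p + q"
    have d: "d > 0" using T n by (simp add: d_def)
    have pq: "p \<ge> 0" "q \<ge> 0" using d by (simp_all add: p_def q_def)
    \<comment> \<open>Since \<open>2 * H > 1\<close>, the fractional part is bounded by the Wiener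
      rate \<open>1/n\<close>, so both components can share one rate.\<close>
    have "real n powr (- (2 * H)) \<le> real n powr (-1)" using n H by (intro powr_mono) auto
    then have npow: "real n powr (- (2 * H)) \<le> 1 / n" using n by (simp add: powr_minus_divide)
    have "d powr (2 * H) = T powr (2 * H) * real n powr (- (2 * H))"
      using T n by (simp add: d_def powr_divide powr_minus_divide)
    also have "\<dots> \<le> T powr (2 * H) * (1 / n)" by (intro mult_left_mono npow) simp
    finally have p_le: "p \<le> a\<^sup>2 * T powr (2 * H) / n"
      unfolding p_def using mult_left_mono[of "d powr (2 * H)" "T powr (2 * H) / n" "a\<^sup>2"] by simp
    have q_eq: "q = b\<^sup>2 * T / n" by (simp add: q_def d_def)
    have v_le: "v \<le> C1 / n" using p_le by (simp add: v_def q_eq C1_def add_divide_distrib)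
    note inc = mixed_grid_increments[OF B W BW T, of _ n _ a b, folded X_def]
    have cov: "expectation (\<lambda>\<omega>. X i \<omega> * X j \<omega>) = p * fgn_cov H (real i - real j) + (if i = j then q else 0)"
      if "i < n" "j < n" for i j
      using inc(2)[OF that] by (simp add: p_def q_def d_def)
    \<comment> \<open>At lag 0 the covariance formula thus reduces to the variance
      \<open>p + q\<close>.\<close>
    have "fgn_cov H 0 = 1" by (simp add: fgn_cov_def)
    then have var: "expectation (\<lambda>\<omega>. (X i \<omega>)\<^sup>2) = v" if "i < n" for i
      using cov[OF that that] by (simp add: power2_eq_square v_def)
    have S: "(\<Sum>j<n. (expectation (\<lambda>\<omega>. X i \<omega> * X j \<omega>))\<^sup>2) \<le> C2 / (real n)\<^sup>2" if i: "i < n" for i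
    proof -
      have sq: "(x + y)\<^sup>2 \<le> 2 * x\<^sup>2 + 2 * y\<^sup>2" for x y :: real
        using sum_squares_bound[of x y] by (simp add: power2_sum)
      have "(\<Sum>j<n. (expectation (\<lambda>\<omega>. X i \<omega> * X j \<omega>))\<^sup>2)
        \<le> (\<Sum>j<n. 2 * p\<^sup>2 * (fgn_cov H (real i - real j))\<^sup>2 + (if i = j then 2 * q\<^sup>2 else 0))"
      proof (rule sum_mono)
        fix j assume "j \<in> {..<n}"
        then show "(expectation (\<lambda>\<omega>. X i \<omega> * X j \<omega>))\<^sup>2 \<le>
          2 * p\<^sup>2 * (fgn_cov H (real i - real j))\<^sup>2 + (if i = j then 2 * q\<^sup>2 else 0)"
          using cov[OF i, of j] sq[of "p * fgn_cov H (real i - real j)" "if i = j then q else 0"]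
          by (simp add: power_mult_distrib split: if_splits)
      qed
      also have "\<dots> = 2 * p\<^sup>2 * (\<Sum>j<n. (fgn_cov H (real i - real j))\<^sup>2) + 2 * q\<^sup>2"
        using i by (simp add: sum.distrib sum_distrib_left)
      also have "\<dots> \<le> 2 * p\<^sup>2 * (2 * G) + 2 * q\<^sup>2"
        unfolding G_def by (intro add_mono mult_left_mono sum_fgn_cov_squared_le H) auto
      also have "\<dots> \<le> 2 * (a\<^sup>2 * T powr (2 * H) / n)\<^sup>2 * (2 * G) + 2 * (b\<^sup>2 * T / n)\<^sup>2"
        using p_le pq G q_eq by (intro add_mono mult_mono power_mono) auto
      also have "\<dots> = C2 / (real n)\<^sup>2"
        by (simp add: C2_def power_divide add_divide_distrib)
      finally show ?thesis .
    qed
    note dev = centered_gaussian_fourth_powers_sum[of n X v, OF inc(1) var S]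
    have eq: "quartic_variation T (\<lambda>t. mixed_model a b B W t \<omega>) n
      - 3 * real n * (a\<^sup>2 * (T / n) powr (2 * H) + b\<^sup>2 * (T / n))\<^sup>2 =
      (\<Sum>i<n. X i \<omega> ^ 4) - 3 * real n * v\<^sup>2" for \<omega>
      by (simp add: quartic_variation_def X_def v_def p_def q_def d_def)
    have "96 * v\<^sup>2 * n * (C2 / (real n)\<^sup>2) \<le> 96 * (C1 / n)\<^sup>2 * n * (C2 / (real n)\<^sup>2)"
      using v_le pq C2 by (intro mult_right_mono mult_left_mono power_mono) (auto simp: v_def)
    also have "\<dots> = 96 * C1\<^sup>2 * C2 / real n ^ 3"
      using n by (simp add: power2_eq_square power3_eq_cube)
    finally show ?thesis unfolding eq using dev by auto
  qed
  show thesis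
    by (rule that[of "96 * C1\<^sup>2 * C2"]) (use main in auto)
qed

text \<open>The weight squared is \<open>2 powr (4 * H * k)\<close> and the variance at
  \<open>n = 2^k\<close> is of order \<open>2 powr (- 3 * k)\<close>: a geometric series of ratio
  \<open>2 powr (4 * H - 3)\<close>, convergent as \<open>H < 3/4\<close>.\<close>

lemma mixed_quartic_variation_AE:
  assumes B: "fractional_brownian_motion M {0..T} H B" and W: "wiener_process M {0..T} W"
    and BW: "independent_processes M {0..T} B W" and T: "T > 0" and H: "1/2 < H" "H < 3/4"
  shows "AE \<omega> in M. (\<lambda>k. 2 powr (2 * H * real k) * (quartic_variation T (\<lambda>t. mixed_model a b B W t \<omega>) (2 ^ k)
      - 3 * 2 ^ k * (a\<^sup>2 * (T / 2 ^ k) powr (2 * H) + b\<^sup>2 * (T / 2 ^ k))\<^sup>2)) \<longlonglongrightarrow> 0"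
proof -
  define R where "R n \<omega> = quartic_variation T (\<lambda>t. mixed_model a b B W t \<omega>) n
      - 3 * real n * (a\<^sup>2 * (T / n) powr (2 * H) + b\<^sup>2 * (T / n))\<^sup>2" for n \<omega>
  from mixed_quartic_variation_deviation[OF B W BW T H, of a b] obtain K
    where int: "\<And>n. n > 0 \<Longrightarrow> integrable M (\<lambda>\<omega>. (R n \<omega>)\<^sup>2)"
    and le: "\<And>n. n > 0 \<Longrightarrow> expectation (\<lambda>\<omega>. (R n \<omega>)\<^sup>2) \<le> K / real n ^ 3"
    unfolding R_def by metis
  have scale: "(2 powr (2 * H * real k))\<^sup>2 * (K / real (2 ^ k) ^ 3) = K * (2 powr (4 * H - 3)) ^ k" for k
  proof -
    have "(2 powr (2 * H * real k))\<^sup>2 = 2 powr (4 * H * real k)"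
      by (simp add: power2_eq_square mult.assoc flip: powr_add)
    moreover have "real (2 ^ k) ^ 3 = 2 powr (3 * real k)"
      by (simp add: powr_realpow[symmetric] powr_powr mult.commute flip: powr_numeral)
    moreover have "(2 powr (4 * H - 3)) ^ k = 2 powr (4 * H * real k - 3 * real k)"
      by (simp add: powr_powr algebra_simps flip: powr_realpow)
    ultimately show ?thesis by (simp add: powr_diff)
  qed
  have "AE \<omega> in M. (\<lambda>k. (2 powr (2 * H * real k) * R (2 ^ k) \<omega>)\<^sup>2) \<longlonglongrightarrow> 0"
  proof (rule AE_tendsto_0_of_summable_expectation[where c = "\<lambda>k. K * (2 powr (4 * H - 3)) ^ k"])
    show "integrable M (\<lambda>\<omega>. (2 powr (2 * H * real k) * R (2 ^ k) \<omega>)\<^sup>2)" for k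
      using int[of "2 ^ k"] by (simp add: power_mult_distrib)
    show "expectation (\<lambda>\<omega>. (2 powr (2 * H * real k) * R (2 ^ k) \<omega>)\<^sup>2) \<le> K * (2 powr (4 * H - 3)) ^ k" for k
    proof -
      have "expectation (\<lambda>\<omega>. (2 powr (2 * H * real k) * R (2 ^ k) \<omega>)\<^sup>2)
        = (2 powr (2 * H * real k))\<^sup>2 * expectation (\<lambda>\<omega>. (R (2 ^ k) \<omega>)\<^sup>2)"
        by (simp add: power_mult_distrib)
      also have "\<dots> \<le> (2 powr (2 * H * real k))\<^sup>2 * (K / real (2 ^ k) ^ 3)"
        by (intro mult_left_mono le) auto
      finally show ?thesis unfolding scale .
    qed
    have "(2::real) powr (4 * H - 3) < 1" using H by (intro powr_less_one) auto
    then show "summable (\<lambda>k. K * (2 powr (4 * H - 3)) ^ k)"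
      by (intro summable_mult summable_geometric) simp
  qed simp
  then show ?thesis
  proof eventually_elim
    case (elim \<omega>)
    then have "(\<lambda>k. 2 powr (2 * H * real k) * R (2 ^ k) \<omega>) \<longlonglongrightarrow> 0"
      by (simp only: power_tendsto_0_iff[OF zero_less_numeral])
    then show ?case by (simp add: R_def)
  qed
qed

end

section \<open>Deterministic asymptotics and passage to logarithms\<close>

text \<open>\<open>m k\<close> has three parts. The one in \<open>b^4\<close> is proportional to
  \<open>1 / 2^k\<close> and cancels against \<open>2 * m (k + 1)\<close>; the mixed one gives the
  constant after scaling; the one in \<open>a^4\<close> keeps a geometric factor.\<close>

lemma mixed_expected_U4_scaled:
  fixes a b T H :: real
  assumes T: "T > 0"
  defines "m \<equiv> \<lambda>k::nat. 3 * 2 ^ k * (a\<^sup>2 * (T / 2 ^ k) powr (2 * H) + b\<^sup>2 * (T / 2 ^ k))\<^sup>2"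
  shows "2 powr (2 * H * real k) * (m k - 2 * m (k + 1)) =
    6 * a\<^sup>2 * b\<^sup>2 * T powr (2 * H + 1) * (1 - 2 powr (1 - 2 * H)) +
    3 * a ^ 4 * T powr (4 * H) * (1 - 2 powr (2 - 4 * H)) * (2 powr (1 - 2 * H)) ^ k"
proof -
  \<comment> \<open>With \<open>y\<close>, \<open>z\<close>, \<open>x\<close> and \<open>n\<close>
    in place of all powers, the claim becomes an identity of rational functions.\<close>
  define y where "y = T powr (2 * H)"
  define z where "z = (2::real) powr (2 * H)"
  have z: "z > 0" by (simp add: z_def)
  have p: "(T / 2 ^ k) powr (2 * H) = y / z ^ k" for k :: nat
    using T by (simp add: y_def z_def powr_divide powr_powr mult.commute flip: powr_realpow)
  have e: "2 powr (2 * H * real k) = z ^ k" by (simp add: z_def powr_powr flip: powr_realpow)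
  have t: "T powr (2 * H + 1) = y * T" "T powr (4 * H) = y\<^sup>2"
    using T by (simp add: y_def powr_add) (simp add: y_def power2_eq_square flip: powr_add)
  have h: "2 powr (1 - 2 * H) = 2 / z" "2 powr (2 - 4 * H) = 4 / z\<^sup>2"
    by (simp_all add: z_def powr_diff power2_eq_square flip: powr_add)
  define x where "x = z ^ k"
  define n :: real where "n = 2 ^ k"
  have "x > 0" "n > 0" using z by (simp_all add: x_def n_def)
  then show ?thesis
    unfolding m_def p e t h power_add power_one_right power_divide using z
    unfolding x_def[symmetric] n_def[symmetric] by (simp add: field_simps eval_nat_numeral)
qed

text \<open>The hypothesis gives \<open>log 2 (u k) = - 2 * H * k + log 2 c + o(1)\<close>. As
  \<open>c > 0\<close>, eventually \<open>u k > 0\<close> and \<open>log2_plus\<close> is the true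
  logarithm.\<close>

lemma log2_estimators_tendsto:
  fixes u :: "nat \<Rightarrow> real"
  assumes lim: "(\<lambda>k. 2 powr (2 * H * real k) * u k) \<longlonglongrightarrow> c" and c: "c > 0"
  shows "(\<lambda>k. - (1 / (2 * real k)) * log2_plus (u k)) \<longlonglongrightarrow> H"
    and "(\<lambda>k. 1/2 * log2_plus (u k / u (k + 1))) \<longlonglongrightarrow> H"
proof -
  define y where "y k = 2 powr (2 * H * real k) * u k" for k
  have y: "y \<longlonglongrightarrow> c" using lim by (simp add: y_def[abs_def])
  have pos: "eventually (\<lambda>k. y k > 0) sequentially" using order_tendstoD(1)[OF y c] .
  have logy: "(\<lambda>k. log 2 (y k)) \<longlonglongrightarrow> log 2 c" using y c by (intro tendsto_intros) auto
  have u: "u k > 0 \<and> log 2 (y k) = log 2 (u k) + 2 * H * real k" if "y k > 0" for k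
  proof -
    from that have "u k > 0" by (simp add: y_def zero_less_mult_iff)
    then show ?thesis by (simp add: y_def log_mult)
  qed
  have "(\<lambda>k. log 2 (y k) * (1 / real k)) \<longlonglongrightarrow> log 2 c * 0"
    by (intro tendsto_mult logy lim_1_over_n)
  then have "(\<lambda>k. H - 1/2 * (log 2 (y k) * (1 / real k))) \<longlonglongrightarrow> H - 1/2 * (log 2 c * 0)"
    by (intro tendsto_diff tendsto_const tendsto_mult_left)
  \<comment> \<open>\<open>k > 0\<close> is required to cancel \<open>real k\<close>, since division
    by zero gives 0.\<close>
  moreover have "eventually (\<lambda>k. H - 1/2 * (log 2 (y k) * (1 / real k)) = - (1 / (2 * real k)) * log2_plus (u k)) sequentially"
    using pos eventually_gt_at_top[of 0]
  proof eventually_elim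
    case (elim k)
    with u[of k] show ?case by (simp add: log2_plus_def field_simps)
  qed
  ultimately show "(\<lambda>k. - (1 / (2 * real k)) * log2_plus (u k)) \<longlonglongrightarrow> H"
    using Lim_transform_eventually by fastforce
  have "(\<lambda>k. 1/2 * (log 2 (y k) - log 2 (y (Suc k)) + 2 * H)) \<longlonglongrightarrow> 1/2 * (log 2 c - log 2 c + 2 * H)"
    by (intro tendsto_mult_left tendsto_add tendsto_diff tendsto_const logy LIMSEQ_Suc[OF logy])
  moreover have "eventually (\<lambda>k. 1/2 * (log 2 (y k) - log 2 (y (Suc k)) + 2 * H) = 1/2 * log2_plus (u k / u (k + 1))) sequentially"
    using pos eventually_sequentially_Suc[THEN iffD2, OF pos]
  proof eventually_elim
    case (elim k)
    with u[of k] u[of "Suc k"] show ?case by (simp add: log2_plus_def log_divide algebra_simps)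
  qed
  ultimately show "(\<lambda>k. 1/2 * log2_plus (u k / u (k + 1))) \<longlonglongrightarrow> H"
    using Lim_transform_eventually by fastforce
qed

theorem theorem3p5:
  fixes M :: "'a measure"
    and B W :: "real \<Rightarrow> 'a \<Rightarrow> real"
    and T a b H :: real
  assumes "prob_space M"
    and "T > 0" and "a > 0" and "b > 0"
    and "1/2 < H" and "H < 3/4"
    and "fractional_brownian_motion M {0..T} H B"
    and "wiener_process M {0..T} W"
    and "independent_processes M {0..T} B W"
  shows "strongly_consistent M (mixed_model a b B W) (H_hat4 T) H \<and>
         strongly_consistent M (mixed_model a b B W) (H_tilde4 T) H"
proof -
  interpret prob_space M by fact
  \<comment> \<open>The limit of the scaled mean of \<open>U4\<close>; it is positive because
    \<open>H > 1/2\<close> makes the last factor positive.\<close>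
  define c where "c = 6 * a\<^sup>2 * b\<^sup>2 * T powr (2 * H + 1) * (1 - 2 powr (1 - 2 * H))"
  have q: "(2::real) powr (1 - 2 * H) < 1" using assms(5) by (intro powr_less_one) auto
  with assms(2-4) have c: "c > 0" by (simp add: c_def)
  define m where "m = (\<lambda>k::nat. 3 * 2 ^ k * (a\<^sup>2 * (T / 2 ^ k) powr (2 * H) + b\<^sup>2 * (T / 2 ^ k))\<^sup>2)"
  have m: "(\<lambda>k. 2 powr (2 * H * real k) * (m k - 2 * m (k + 1))) \<longlonglongrightarrow> c"
  proof -
    have "(\<lambda>k. c + 3 * a ^ 4 * T powr (4 * H) * (1 - 2 powr (2 - 4 * H)) * (2 powr (1 - 2 * H)) ^ k)
      \<longlonglongrightarrow> c + 3 * a ^ 4 * T powr (4 * H) * (1 - 2 powr (2 - 4 * H)) * 0"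
      using q by (intro tendsto_intros LIMSEQ_realpow_zero) auto
    then show ?thesis
      unfolding m_def mixed_expected_U4_scaled[OF assms(2)] c_def by simp
  qed
  have "AE \<omega> in M. (\<lambda>k. 2 powr (2 * H * real k) * U4 T (\<lambda>t. mixed_model a b B W t \<omega>) k) \<longlonglongrightarrow> c"
    using mixed_quartic_variation_AE[OF assms(7-9) assms(2,5,6), of a b]
  proof eventually_elim
    case (elim \<omega>)
    define r where "r k = 2 powr (2 * H * real k) *
      (quartic_variation T (\<lambda>t. mixed_model a b B W t \<omega>) (2 ^ k) - m k)" for k
    have r: "r \<longlonglongrightarrow> 0" using elim unfolding r_def[abs_def] m_def .
    \<comment> \<open>The error at level \<open>k + 1\<close> carries the weight of that level; the
      factor \<open>2 powr (- 2 * H)\<close> brings it back to level \<open>k\<close>.\<close>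
    have "(\<lambda>k. 2 powr (2 * H * real k) * (m k - 2 * m (k + 1)) + r k - 2 * 2 powr (- 2 * H) * r (Suc k))
      \<longlonglongrightarrow> c + 0 - 2 * 2 powr (- 2 * H) * 0"
      by (intro tendsto_intros m r LIMSEQ_Suc[OF r])
    moreover have "2 powr (2 * H * real k) * (m k - 2 * m (k + 1)) + r k - 2 * 2 powr (- 2 * H) * r (Suc k)
      = 2 powr (2 * H * real k) * U4 T (\<lambda>t. mixed_model a b B W t \<omega>) k" for k :: nat
    proof -
      have "2 powr (2 * H * real (Suc k)) = 2 powr (2 * H * real k) * 2 powr (2 * H)"
        by (simp add: algebra_simps flip: powr_add)
      then show ?thesis
        by (simp add: r_def U4_def powr_minus field_simps)
    qed
    ultimately show ?case by simp
  qed
  then have "AE \<omega> in M. (\<lambda>k. H_hat4 T (\<lambda>t. mixed_model a b B W t \<omega>) k) \<longlonglongrightarrow> H \<and>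
    (\<lambda>k. H_tilde4 T (\<lambda>t. mixed_model a b B W t \<omega>) k) \<longlonglongrightarrow> H"
    unfolding H_hat4_def H_tilde4_def
    by eventually_elim (use log2_estimators_tendsto c in blast)
  then show ?thesis unfolding strongly_consistent_def by (auto elim: eventually_mono)
qed

end
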